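(* Let $f \in \mathbb{C}[x,y]$ be a nonconstant polynomial of total degree $D$, and let $p \in \mathbb{C}^2$ be a point with $f(p) \neq 0$. Then for every integer $k \ge 1$, $$\max_{0 \le i \le k} \left|\frac{f_{i,k-i}(p)}{f(p)}\right|^{1/k} < \frac{2D}{\mathrm{sep}(p, V(f))}.$$
   Context: For a polynomial $f \in \mathbb{C}[x,y]$ and integers $i,j \ge 0$, $f_{i,j}(p) := \frac{\partial^{i+j} f}{\partial x^i \, \partial y^j}(p)$ denotes the mixed partial derivative of $f$ at $p$. $V(f) := \{ z \in \mathbb{C}^2 : f(z) = 0\}$ is the variety of $f$, and $\mathrm{sep}(p, V(f)) := \inf_{z \in V(f)} \|p - z\|$, where $\|\cdot\|$ is the standard Hermitian (Euclidean) norm on $\mathbb{C}^2$. *)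

theory Defs
  imports "HOL-Analysis.Analysis" "HOL-Computational_Algebra.Polynomial"
begin

text \<open>
  The ring \<open>\<complex>[x,y]\<close> is represented as \<open>\<complex>[x][y]\<close>, i.e. by the type \<^typ>\<open>complex poly poly\<close>: the outer
  variable is \<open>y\<close>, the inner one is \<open>x\<close>, and the coefficient of \<open>x\<^sup>i y\<^sup>j\<close> in \<open>f\<close> is
  \<open>coeff (coeff f j) i\<close>. Points of \<open>\<complex>\<^sup>2\<close> are elements of \<^typ>\<open>complex \<times> complex\<close>, whose library
  norm is the Hermitian norm.
\<close>

definition eval2 :: "complex poly poly \<Rightarrow> complex \<times> complex \<Rightarrow> complex" where
  "eval2 f p = poly (poly f [:snd p:]) (fst p)"

definition total_degree :: "complex poly poly \<Rightarrow> nat" where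
  "total_degree f =
     (if f = 0 then 0 else Max {i + j | i j. coeff (coeff f j) i \<noteq> 0})"

definition pderiv_x :: "complex poly poly \<Rightarrow> complex poly poly" where
  "pderiv_x f = map_poly pderiv f"

definition pderiv_y :: "complex poly poly \<Rightarrow> complex poly poly" where
  "pderiv_y f = pderiv f"

definition mixed_pderiv :: "nat \<Rightarrow> nat \<Rightarrow> complex poly poly \<Rightarrow> complex poly poly" where
  "mixed_pderiv i j f = (pderiv_x ^^ i) ((pderiv_y ^^ j) f)"

definition variety :: "complex poly poly \<Rightarrow> (complex \<times> complex) set" where
  "variety f = {z. eval2 f z = 0}"

definition sep :: "complex \<times> complex \<Rightarrow> (complex \<times> complex) set \<Rightarrow> real" where
  "sep p V = (INF z\<in>V. norm (p - z))"

text \<open>The formal partial derivatives agree with the analytic ones.\<close>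

lemma eval2_pCons: "eval2 (pCons a f) p = poly a (fst p) + snd p * eval2 f p"
  by (simp add: eval2_def)

lemma eval2_0: "eval2 0 p = 0"
  by (simp add: eval2_def)

lemma pderiv_x_0: "pderiv_x 0 = 0"
  by (simp add: pderiv_x_def)

lemma pderiv_x_pCons: "pderiv_x (pCons a f) = pCons (pderiv a) (pderiv_x f)"
  by (simp add: pderiv_x_def map_poly_pCons)

lemma has_field_derivative_eval2_x:
  "((\<lambda>t. eval2 f (t, y)) has_field_derivative eval2 (pderiv_x f) (x, y)) (at x)"
proof (induction f)
  case 0
  then show ?case by (simp add: eval2_0 pderiv_x_0)
next
  case (pCons a f)
  show ?case
    unfolding eval2_pCons pderiv_x_pCons fst_conv snd_conv
    by (intro DERIV_add poly_DERIV DERIV_cmult pCons.IH)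
qed

lemma has_field_derivative_eval2_y:
  "((\<lambda>t. eval2 f (x, t)) has_field_derivative eval2 (pderiv_y f) (x, y)) (at y)"
proof (induction f)
  case 0
  then show ?case by (simp add: eval2_0 pderiv_y_def)
next
  case (pCons a f)
  have "eval2 (pderiv_y (pCons a f)) (x, y)
      = eval2 f (x, y) + y * eval2 (pderiv_y f) (x, y)"
    by (simp add: eval2_def pderiv_y_def pderiv_pCons algebra_simps)
  then show ?case
    unfolding eval2_pCons fst_conv snd_conv
    by (auto intro!: derivative_eq_intros pCons.IH)
qed

lemma deriv_funpow_eval2_x:
  "(deriv ^^ i) (\<lambda>t. eval2 f (t, y)) = (\<lambda>t. eval2 ((pderiv_x ^^ i) f) (t, y))"
  by (induction i) (auto simp: DERIV_imp_deriv[OF has_field_derivative_eval2_x])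

lemma deriv_funpow_eval2_y:
  "(deriv ^^ j) (\<lambda>t. eval2 f (x, t)) = (\<lambda>t. eval2 ((pderiv_y ^^ j) f) (x, t))"
  by (induction j) (auto simp: DERIV_imp_deriv[OF has_field_derivative_eval2_y])

lemma eval2_mixed_pderiv:
  "eval2 (mixed_pderiv i j f) (x, y) =
     (deriv ^^ i) (\<lambda>s. (deriv ^^ j) (\<lambda>t. eval2 f (s, t)) y) x"
  by (simp add: mixed_pderiv_def deriv_funpow_eval2_x deriv_funpow_eval2_y)

end

theory Submission
  imports Defs "HOL-Complex_Analysis.Cauchy_Integral_Formula"
    "HOL-Computational_Algebra.Fundamental_Theorem_Algebra"
begin

text \<open>
  Write \<open>s = sep p (V(f))\<close>. For \<open>\<bar>z\<bar> = 1\<close>, the restriction \<open>g(t) = f(p + t(z, 1))\<close> is a polynomial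
  of degree at most \<open>D\<close> whose roots have modulus at least \<open>s/\<surd>2\<close>, since \<open>(z, 1)\<close> has norm \<open>\<surd>2\<close>.
  Factoring \<open>g\<close> into linear factors bounds its \<open>k\<close>-th coefficient by \<open>(D choose k) \<bar>f(p)\<bar> (\<surd>2/s)\<^sup>k\<close>,
  so \<open>\<bar>g\<^sup>(\<^sup>k\<^sup>)(0)\<bar> \<le> \<bar>f(p)\<bar> (\<surd>2 D/s)\<^sup>k\<close>. As a function of \<open>z\<close>, \<open>g\<^sup>(\<^sup>k\<^sup>)(0)\<close> is the polynomial
  \<open>\<Sum>i\<le>k. (k choose i) f\<^bsub>i,k-i\<^esub>(p) z\<^sup>i\<close>, and Cauchy's inequality on the unit circle transfers the bound to
  each coefficient. The strict inequality comes from \<open>\<surd>2 < 2\<close>.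
\<close>

section \<open>Coefficients of a polynomial without roots near the origin\<close>

text \<open>Induction splits off one linear factor, and Pascal's rule merges the two resulting
  terms. Only an upper bound \<open>n\<close> on the degree is asked for, because restricting to a
  line may lower the degree.\<close>

lemma coeff_le_of_roots_outside:
  fixes g :: "complex poly"
  assumes "degree g \<le> n" and "r > 0" and "\<And>z. poly g z = 0 \<Longrightarrow> r \<le> cmod z"
  shows "cmod (coeff g k) \<le> real (n choose k) * cmod (coeff g 0) / r ^ k"
  using assms(1,3)
proof (induction n arbitrary: g k)
  case 0
  then show ?case by (cases k) (auto simp: coeff_eq_0)
next
  case (Suc n)
  show ?case
  proof (cases "degree g = 0")
    case True
    then show ?thesis
      by (cases k) (use \<open>r > 0\<close> in \<open>auto simp: coeff_eq_0\<close>)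
  next
    case False
    then have "\<not> constant (poly g)" by (simp add: constant_degree)
    then obtain w where w: "poly g w = 0"
      using fundamental_theorem_of_algebra by blast
    then obtain h where h: "g = [:- w, 1:] * h"
      by (metis dvdE poly_eq_0_iff_dvd)
    have "h \<noteq> 0" using h False by auto
    then have "degree g = Suc (degree h)"
      unfolding h by (subst degree_mult_eq) auto
    then have dh: "degree h \<le> n" using Suc.prems(1) by simp
    have IH: "cmod (coeff h k) \<le> real (n choose k) * cmod (coeff h 0) / r ^ k" for k
      by (rule Suc.IH[OF dh]) (use Suc.prems(2) h in auto)
    have rw: "r \<le> cmod w" using Suc.prems(2) w .
    show ?thesis
    proof (cases k)
      case 0
      then show ?thesis by simp
    next
      case (Suc m)
      have "cmod (coeff g k) = cmod (coeff h m - w * coeff h (Suc m))"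
        unfolding h by (simp add: Suc)
      also have "\<dots> \<le> cmod (coeff h m) + cmod w * cmod (coeff h (Suc m))"
        by (metis norm_mult norm_triangle_ineq4)
      also have "\<dots> \<le> real (n choose m) * cmod (coeff h 0) / r ^ m
          + cmod w * (real (n choose Suc m) * cmod (coeff h 0) / r ^ Suc m)"
        by (intro add_mono mult_left_mono IH) auto
      \<comment> \<open>The factor \<open>r\<close> is exposed in order to be replaced by
        \<open>cmod w\<close>; both terms then carry \<open>cmod w * cmod (coeff h 0)\<close>, which
        is \<open>cmod (coeff g 0)\<close>.\<close>
      also have "real (n choose m) * cmod (coeff h 0) / r ^ m
          = r * (real (n choose m) * cmod (coeff h 0) / r ^ Suc m)"
        using \<open>r > 0\<close> by simp
      also have "\<dots> \<le> cmod w * (real (n choose m) * cmod (coeff h 0) / r ^ Suc m)"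
        using rw \<open>r > 0\<close> by (intro mult_right_mono) auto
      also have "\<dots> + cmod w * (real (n choose Suc m) * cmod (coeff h 0) / r ^ Suc m)
          = real (Suc n choose k) * cmod (coeff g 0) / r ^ k"
        unfolding h by (simp add: Suc norm_mult algebra_simps add_divide_distrib)
      finally show ?thesis by simp
    qed
  qed
qed

section \<open>Restriction to a line and its Taylor coefficients\<close>

text \<open>Binomial expansion of the iterated directional derivative. The family
  \<open>a i j\<close> abstracts the mixed derivatives restricted to a line with direction
  \<open>(u, v)\<close>, and the hypothesis is the chain rule.\<close>

lemma higher_pderiv_binomial:
  fixes a :: "nat \<Rightarrow> nat \<Rightarrow> 'a :: idom poly"
  assumes a: "\<And>i j. pderiv (a i j) = smult u (a (Suc i) j) + smult v (a i (Suc j))"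
  shows "(pderiv ^^ k) (a 0 0)
     = (\<Sum>i\<le>k. smult (of_nat (k choose i) * u ^ i * v ^ (k - i)) (a i (k - i)))"
proof (induction k)
  case 0
  then show ?case by simp
next
  case (Suc k)
  define c :: "nat \<Rightarrow> nat \<Rightarrow> 'a" where "c n i = of_nat (n choose i) * u ^ i * v ^ (n - i)" for n i
  have c0: "c (Suc k) 0 = v * c k 0" by (simp add: c_def)
  have cS: "c (Suc k) (Suc i) = u * c k i + v * c k (Suc i)" if "i < k" for i
    using that by (simp add: c_def algebra_simps flip: Suc_diff_Suc)
  have cl: "c (Suc k) (Suc k) = u * c k k" by (simp add: c_def)
  have "(pderiv ^^ Suc k) (a 0 0) = pderiv (\<Sum>i\<le>k. smult (c k i) (a i (k - i)))"
    using Suc by (simp add: c_def)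
  also have "\<dots> = (\<Sum>i\<le>k. smult (u * c k i) (a (Suc i) (k - i)))
       + (\<Sum>i\<le>k. smult (v * c k i) (a i (Suc (k - i))))"
    by (simp add: higher_pderiv_sum[of 1, simplified] pderiv_smult a smult_add_right sum.distrib mult.commute)
  \<comment> \<open>Peeling the top term off this sum and the bottom term off the other aligns both
    on \<open>a (Suc i) (k - i)\<close> for \<open>i < k\<close>, where Pascal's rule
    \<open>cS\<close> applies.\<close>
  also have "(\<Sum>i\<le>k. smult (u * c k i) (a (Suc i) (k - i)))
      = (\<Sum>i<k. smult (u * c k i) (a (Suc i) (k - i))) + smult (u * c k k) (a (Suc k) 0)"
    by (simp add: lessThan_Suc_atMost[symmetric])
  also have "(\<Sum>i\<le>k. smult (v * c k i) (a i (Suc (k - i))))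
      = smult (v * c k 0) (a 0 (Suc k)) + (\<Sum>i<k. smult (v * c k (Suc i)) (a (Suc i) (k - i)))"
    by (simp add: sum.atMost_shift Suc_diff_Suc)
  also have "(\<Sum>i<k. smult (u * c k i) (a (Suc i) (k - i))) + smult (u * c k k) (a (Suc k) 0)
      + (smult (v * c k 0) (a 0 (Suc k)) + (\<Sum>i<k. smult (v * c k (Suc i)) (a (Suc i) (k - i))))
     = smult (c (Suc k) 0) (a 0 (Suc k)) + (\<Sum>i<k. smult (c (Suc k) (Suc i)) (a (Suc i) (k - i)))
        + smult (c (Suc k) (Suc k)) (a (Suc k) 0)"
    by (simp add: c0 cl cS smult_add_left sum.distrib)
  also have "\<dots> = (\<Sum>i\<le>Suc k. smult (c (Suc k) i) (a i (Suc k - i)))"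
    by (subst sum.atMost_Suc) (simp add: sum.atMost_shift)
  finally show ?case by (simp add: c_def)
qed

text \<open>The map \<open>t\<close> to \<open>f (p + t v)\<close> as a formal polynomial. Composing
  the inner coefficients first lets the outer variable be evaluated at a polynomial in the same
  \<open>t\<close>.\<close>

definition line_poly :: "complex poly poly \<Rightarrow> complex \<times> complex \<Rightarrow> complex \<times> complex \<Rightarrow> complex poly" where
  "line_poly f p v = poly (map_poly (\<lambda>a. pcompose a [:fst p, fst v:]) f) [:snd p, snd v:]"

lemma line_poly_0 [simp]: "line_poly 0 p v = 0"
  by (simp add: line_poly_def)

lemma line_poly_pCons:
  "line_poly (pCons a f) p v = pcompose a [:fst p, fst v:] + [:snd p, snd v:] * line_poly f p v"
  unfolding line_poly_def by (subst map_poly_pCons) auto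

lemma line_poly_add: "line_poly (f + g) p v = line_poly f p v + line_poly g p v"
  by (induction f g rule: poly_induct2)
     (simp_all add: line_poly_pCons pcompose_add algebra_simps)

lemma poly_line_poly:
  "poly (line_poly f p v) t = eval2 f (fst p + t * fst v, snd p + t * snd v)"
  by (induction f) (simp_all add: line_poly_pCons eval2_0 eval2_pCons poly_pcompose algebra_simps)

lemma pderiv_line_poly:
  "pderiv (line_poly f p v)
     = smult (fst v) (line_poly (pderiv_x f) p v) + smult (snd v) (line_poly (pderiv_y f) p v)"
proof (induction f)
  case 0
  then show ?case by (simp add: pderiv_x_0 pderiv_y_def)
next
  case (pCons a f)
  have *: "pderiv [:s, t:] = [:t:]" for s t :: complex
    by (simp add: pderiv_pCons)
  have **: "line_poly (pCons 0 g) p v = [:snd p, snd v:] * line_poly g p v" for g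
    by (simp add: line_poly_pCons)
  show ?case
    unfolding pderiv_x_pCons pderiv_y_def pderiv_pCons line_poly_add **
    unfolding line_poly_pCons pderiv_add pderiv_mult pderiv_pcompose pCons.IH * pderiv_y_def
    by (simp add: algebra_simps smult_add_right)
qed

lemma pderiv_x_y_commute: "pderiv_y (pderiv_x f) = pderiv_x (pderiv_y f)"
proof -
  have add: "pderiv_x (f + g) = pderiv_x f + pderiv_x g" for f g
    by (simp add: poly_eq_iff pderiv_x_def coeff_map_poly pderiv_add)
  show ?thesis
    unfolding pderiv_y_def
    by (induction f) (simp_all add: pderiv_x_0 pderiv_x_pCons pderiv_pCons add)
qed

lemma pderiv_x_mixed_pderiv: "pderiv_x (mixed_pderiv i j f) = mixed_pderiv (Suc i) j f"
  by (simp add: mixed_pderiv_def)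

lemma pderiv_y_mixed_pderiv: "pderiv_y (mixed_pderiv i j f) = mixed_pderiv i (Suc j) f"
proof -
  have "pderiv_y ((pderiv_x ^^ i) g) = (pderiv_x ^^ i) (pderiv_y g)" for g
    by (induction i) (simp_all add: pderiv_x_y_commute)
  then show ?thesis by (simp add: mixed_pderiv_def)
qed

text \<open>Both sides are the \<open>k\<close>-th derivative of the restriction at
  \<open>0\<close>. For \<open>v = (z, 1)\<close> the right side is a polynomial in
  \<open>z\<close>.\<close>

lemma fact_coeff_line_poly:
  "fact k * coeff (line_poly f p v) k
     = (\<Sum>i\<le>k. of_nat (k choose i) * fst v ^ i * snd v ^ (k - i) * eval2 (mixed_pderiv i (k - i) f) p)"
proof -
  have "fact k * coeff (line_poly f p v) k = poly ((pderiv ^^ k) (line_poly f p v)) 0"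
    by (simp add: poly_0_coeff_0 coeff_higher_pderiv pochhammer_fact)
  also have "(pderiv ^^ k) (line_poly f p v)
     = (\<Sum>i\<le>k. smult (of_nat (k choose i) * fst v ^ i * snd v ^ (k - i)) (line_poly (mixed_pderiv i (k - i) f) p v))"
    using higher_pderiv_binomial[of "\<lambda>i j. line_poly (mixed_pderiv i j f) p v" "fst v" "snd v" k]
    by (simp add: pderiv_line_poly pderiv_x_mixed_pderiv pderiv_y_mixed_pderiv)
       (simp add: mixed_pderiv_def)
  finally show ?thesis
    by (simp add: poly_sum poly_line_poly)
qed

section \<open>Total degree\<close>

lemma finite_coeff_support: "finite {i + j | i j. coeff (coeff f j) i \<noteq> 0}"
proof (rule finite_subset)
  show "{i + j | i j. coeff (coeff f j) i \<noteq> 0}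
      \<subseteq> (\<Union>j\<le>degree f. (\<lambda>i. i + j) ` {..degree (coeff f j)})"
  proof safe
    fix i j assume "coeff (coeff f j) i \<noteq> 0"
    then have "j \<le> degree f" "i \<le> degree (coeff f j)"
      by (auto intro!: le_degree)
    then show "i + j \<in> (\<Union>j\<le>degree f. (\<lambda>i. i + j) ` {..degree (coeff f j)})" by auto
  qed
qed auto

lemma le_total_degree:
  assumes "coeff (coeff f j) i \<noteq> 0"
  shows "i + j \<le> total_degree f"
proof -
  have "f \<noteq> 0" using assms by auto
  then show ?thesis unfolding total_degree_def
    using assms by (auto intro!: Max_ge finite_coeff_support)
qed

lemma total_degree_eq_0D:
  assumes "total_degree f = 0"
  obtains c where "f = [:[:c:]:]"
proof
  show "f = [:[:coeff (coeff f 0) 0:]:]"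
  proof (intro poly_eqI)
    fix j i
    show "coeff (coeff f j) i = coeff (coeff [:[:coeff (coeff f 0) 0:]:] j) i"
      using le_total_degree[of f j i] assms by (cases i; cases j; force)
  qed
qed

text \<open>Each monomial of \<open>f\<close> becomes a product of \<open>i + j\<close> polynomials
  of degree at most 1.\<close>

lemma degree_line_poly: "degree (line_poly f p v) \<le> total_degree f"
proof -
  have deg: "degree [:s, t:] \<le> 1" for s t :: complex by simp
  have "line_poly f p v = (\<Sum>j\<le>degree (map_poly (\<lambda>a. pcompose a [:fst p, fst v:]) f).
      pcompose (coeff f j) [:fst p, fst v:] * [:snd p, snd v:] ^ j)"
    unfolding line_poly_def
    by (simp add: poly_altdef coeff_map_poly)
  also have "degree \<dots> \<le> total_degree f"
  proof (intro degree_sum_le)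
    fix j
    have "pcompose (coeff f j) [:fst p, fst v:] * [:snd p, snd v:] ^ j
      = (\<Sum>i\<le>degree (coeff f j). smult (coeff (coeff f j) i) ([:fst p, fst v:] ^ i * [:snd p, snd v:] ^ j))"
      by (simp add: pcompose_altdef poly_altdef coeff_map_poly sum_distrib_right degree_map_poly)
    also have "degree \<dots> \<le> total_degree f"
    proof (intro degree_sum_le)
      fix i
      show "degree (smult (coeff (coeff f j) i) ([:fst p, fst v:] ^ i * [:snd p, snd v:] ^ j)) \<le> total_degree f"
      proof (cases "coeff (coeff f j) i = 0")
        case False
        have "degree ([:fst p, fst v:] ^ i * [:snd p, snd v:] ^ j)
          \<le> degree [:fst p, fst v:] * i + degree [:snd p, snd v:] * j"
          by (rule order.trans[OF degree_mult_le]) (intro add_mono degree_power_le)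
        also have "\<dots> \<le> i + j"
          using deg by (intro add_mono) (auto)
        also note le_total_degree[OF False]
        finally show ?thesis using False by simp
      qed auto
    qed auto
    finally show "degree (pcompose (coeff f j) [:fst p, fst v:] * [:snd p, snd v:] ^ j) \<le> total_degree f" .
  qed auto
  finally show ?thesis .
qed

section \<open>The variety and its distance from a point\<close>

text \<open>Needed because \<open>sep p {}\<close> is an unspecified infimum.\<close>

lemma variety_nonempty:
  assumes "\<And>c. f \<noteq> [:[:c:]:]"
  shows "variety f \<noteq> {}"
proof
  assume "variety f = {}"
  then have nz: "poly (poly f [:y:]) x \<noteq> 0" for x y
    by (auto simp: variety_def eval2_def)
  have const: "degree g = 0" if "\<And>x. poly g x \<noteq> 0" for g :: "complex poly"
    using that fundamental_theorem_of_algebra[of g] constant_degree[of g] by auto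
  \<comment> \<open>For each fixed \<open>y\<close> a zero-free polynomial in \<open>x\<close> is
    constant, so all positive powers of \<open>x\<close> disappear from \<open>f\<close>; the
    remaining polynomial in \<open>y\<close> is zero-free and hence constant too.\<close>
  have deg0: "degree (poly f [:y:]) = 0" for y
    using const nz by blast
  have cf: "coeff (poly f [:y:]) i = poly (map_poly (\<lambda>a. coeff a i) f) y" for y i
    by (induction f) (simp_all add: map_poly_pCons)
  have z: "map_poly (\<lambda>a. coeff a i) f = 0" if "i > 0" for i
    using that deg0 cf by (metis coeff_eq_0 poly_all_0_iff_0)
  have "poly (map_poly (\<lambda>a. coeff a 0) f) y \<noteq> 0" for y
    using nz[of y 0] by (simp add: poly_0_coeff_0 flip: cf)
  then have z0: "degree (map_poly (\<lambda>a. coeff a 0) f) = 0" using const by blast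
  have "f = [:[:coeff (coeff f 0) 0:]:]"
  proof (intro poly_eqI)
    fix j i
    have "coeff (coeff f j) i = coeff (map_poly (\<lambda>a. coeff a i) f) j"
      by (simp add: coeff_map_poly)
    then show "coeff (coeff f j) i = coeff (coeff [:[:coeff (coeff f 0) 0:]:] j) i"
      using z[of i] z0 by (cases i; cases j) (auto simp: coeff_eq_0)
  qed
  then show False using assms by blast
qed

lemma sep_le:
  assumes "z \<in> V"
  shows "sep p V \<le> norm (p - z)"
  unfolding sep_def using assms by (intro cINF_lower bdd_belowI[of _ 0]) auto

text \<open>A closed set has positive distance from a point outside it. Nonemptiness identifies
  \<open>sep\<close> with \<open>infdist\<close>.\<close>

lemma sep_variety_pos:
  assumes "variety f \<noteq> {}" and "eval2 f p \<noteq> 0"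
  shows "sep p (variety f) > 0"
proof -
  have "continuous_on UNIV (eval2 f)"
  proof (induction f)
    case 0
    then show ?case by (simp add: eval2_def)
  next
    case (pCons a f)
    show ?case unfolding eval2_pCons
      by (intro continuous_intros pCons.IH)
  qed
  then have "closed (variety f)"
    unfolding variety_def by (simp add: closed_Collect_eq)
  moreover have "sep p (variety f) = infdist p (variety f)"
    using assms(1) by (simp add: sep_def infdist_notempty dist_norm)
  ultimately show ?thesis
    using in_closed_iff_infdist_zero[of "variety f" p] assms infdist_nonneg[of p "variety f"]
    by (auto simp: variety_def)
qed

section \<open>From bounds on lines to bounds on mixed derivatives\<close>

lemma norm_coeff_le_of_unit_circle:
  fixes q :: "complex poly"
  assumes "\<And>z. cmod z = 1 \<Longrightarrow> cmod (poly q z) \<le> B"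
  shows "cmod (coeff q i) \<le> B"
proof -
  have d: "(deriv ^^ i) (poly q) = poly ((pderiv ^^ i) q)"
    by (induction i) (auto simp: DERIV_imp_deriv[OF poly_DERIV])
  have "cmod ((deriv ^^ i) (poly q) 0) \<le> fact i * B / 1 ^ i"
    by (rule Cauchy_inequality) (use assms in \<open>auto intro!: holomorphic_intros continuous_intros\<close>)
  then show ?thesis
    by (simp add: d poly_0_coeff_0 coeff_higher_pderiv pochhammer_fact[symmetric] norm_mult)
qed

text \<open>For \<open>k \<le> n\<close> the left side is a falling factorial with \<open>k\<close>
  factors, each at most \<open>n\<close>; otherwise it vanishes.\<close>

lemma fact_mult_choose_le_power: "fact k * real (n choose k) \<le> real n ^ k"
proof (cases "k \<le> n")
  case True
  have "fact k * (n choose k) \<le> n ^ k"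
    using binomial_fact_pow[of n k] by (simp add: mult.commute)
  then have "real (fact k * (n choose k)) \<le> real (n ^ k)"
    unfolding of_nat_le_iff .
  then show ?thesis by simp
qed (simp add: binomial_eq_0)

lemma cmod_mixed_pderiv_le:
  assumes s: "sep p (variety f) > 0" and "i \<le> k"
  shows "cmod (eval2 (mixed_pderiv i (k - i) f) p)
      \<le> (sqrt 2 * real (total_degree f) / sep p (variety f)) ^ k * cmod (eval2 f p)"
proof -
  define s where "s = sep p (variety f)"
  define B where "B = (sqrt 2 * real (total_degree f) / s) ^ k * cmod (eval2 f p)"
  \<comment> \<open>\<open>q\<close> collects the \<open>k\<close>-th derivatives at
    \<open>0\<close> along all directions \<open>(z, 1)\<close>, so its coefficients isolate the
    single mixed derivatives.\<close>
  define q where "q = (\<Sum>i\<le>k. monom (of_nat (k choose i) * eval2 (mixed_pderiv i (k - i) f) p) i)"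
  have "cmod (poly q z) \<le> B" if z: "cmod z = 1" for z
  proof -
    define g where "g = line_poly f p (z, 1)"
    have q: "poly q z = fact k * coeff g k"
      unfolding q_def g_def by (simp add: fact_coeff_line_poly poly_sum poly_monom mult_ac)
    have roots: "s / sqrt 2 \<le> cmod t" if "poly g t = 0" for t
    proof -
      have "(fst p + t * z, snd p + t) \<in> variety f"
        using that by (simp add: g_def poly_line_poly variety_def)
      then have "s \<le> norm (p - (fst p + t * z, snd p + t))"
        unfolding s_def by (rule sep_le)
      also have "\<dots> = sqrt 2 * cmod t"
        by (cases p) (simp add: norm_Pair norm_mult z real_sqrt_mult)
      finally show ?thesis by (simp add: field_simps)
    qed
    have "cmod (coeff g k) \<le> real (total_degree f choose k) * cmod (coeff g 0) / (s / sqrt 2) ^ k"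
      by (rule coeff_le_of_roots_outside) (use s roots in \<open>auto simp: g_def s_def degree_line_poly\<close>)
    also have "coeff g 0 = eval2 f p"
      using poly_line_poly[of f p "(z, 1)" 0] by (simp add: g_def poly_0_coeff_0)
    finally have "cmod (poly q z)
        \<le> fact k * (real (total_degree f choose k) * cmod (eval2 f p) / (s / sqrt 2) ^ k)"
      unfolding q norm_mult by (intro mult_mono) auto
    also have "\<dots> = (fact k * real (total_degree f choose k)) * (cmod (eval2 f p) / (s / sqrt 2) ^ k)"
      by simp
    also have "\<dots> \<le> real (total_degree f) ^ k * (cmod (eval2 f p) / (s / sqrt 2) ^ k)"
      using s by (intro mult_right_mono fact_mult_choose_le_power) (auto simp: s_def)
    also have "\<dots> = B"
      unfolding B_def by (simp add: power_divide power_mult_distrib)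
    finally show ?thesis .
  qed
  then have "cmod (coeff q i) \<le> B" by (rule norm_coeff_le_of_unit_circle)
  also have "coeff q i = of_nat (k choose i) * eval2 (mixed_pderiv i (k - i) f) p"
    using \<open>i \<le> k\<close> by (simp add: q_def coeff_sum if_distrib sum.delta)
  finally have "real (k choose i) * cmod (eval2 (mixed_pderiv i (k - i) f) p) \<le> B"
    by (simp add: norm_mult)
  moreover have "1 * cmod (eval2 (mixed_pderiv i (k - i) f) p)
      \<le> real (k choose i) * cmod (eval2 (mixed_pderiv i (k - i) f) p)"
    using \<open>i \<le> k\<close> by (intro mult_right_mono) (auto simp: Suc_le_eq)
  ultimately show ?thesis unfolding B_def s_def by linarith
qed

theorem theorem1:
  fixes f :: "complex poly poly" and p :: "complex \<times> complex" and D k :: nat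
  assumes nonconstant: "\<And>c. f \<noteq> [:[:c:]:]"
    and degree: "total_degree f = D"
    and nonzero: "eval2 f p \<noteq> 0"
    and k: "k \<ge> 1"
  shows "(MAX i\<in>{0..k}. root k (cmod (eval2 (mixed_pderiv i (k - i) f) p / eval2 f p)))
           < 2 * real D / sep p (variety f)"
proof -
  define s where "s = sep p (variety f)"
  have s: "s > 0"
    unfolding s_def using variety_nonempty nonconstant nonzero by (intro sep_variety_pos) auto
  \<comment> \<open>For \<open>D = 0\<close> the final comparison of \<open>sqrt 2 * D\<close> with
    \<open>2 * D\<close> would not be strict.\<close>
  have D: "D > 0"
    using nonconstant degree total_degree_eq_0D by (metis gr0I)
  have "root k (cmod (eval2 (mixed_pderiv i (k - i) f) p / eval2 f p)) < 2 * real D / s"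
    if "i \<le> k" for i
  proof -
    have "cmod (eval2 (mixed_pderiv i (k - i) f) p / eval2 f p) \<le> (sqrt 2 * real D / s) ^ k"
      using cmod_mixed_pderiv_le[of p f i k] s that nonzero degree
      by (simp add: s_def norm_divide divide_le_eq)
    then have "root k (cmod (eval2 (mixed_pderiv i (k - i) f) p / eval2 f p))
        \<le> root k ((sqrt 2 * real D / s) ^ k)"
      using k by simp
    also have "\<dots> = sqrt 2 * real D / s"
      using k s by (intro real_root_power_cancel) auto
    also have "\<dots> < 2 * real D / s"
      using D s sqrt2_less_2 by (simp add: divide_strict_right_mono)
    finally show ?thesis .
  qed
  then show ?thesis
    unfolding s_def by (subst Max_less_iff) auto
qed

end
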